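(* Let $m\ge 1$ and $A\in\mathbb{R}^{m\times m}$. Then the following assertions are equivalent: 1. Each member of $\mathcal{O}(A)$ is an FS-matrix. 2. Each member of $\mathcal{O}(A)$ is a Q-matrix. 3. Each member of $\mathcal{O}(A)$ is a P-matrix. 4. $A$ is a positive definite matrix. Hence, if any of the assertions 1, 2, 3, 4 holds, then $A$ possesses the $K$-P-, $K$-Q- and $K$-FS-properties for every simplicial cone $K\subset\mathbb{R}^m$.
   Context: $\mathbb{R}^m$ is the space of column vectors with the standard scalar product $\langle\cdot,\cdot\rangle$, and $x\perp y$ means $\langle x,y\rangle=0$. $\mathbb{R}^m_+$ is the non-negative orthant. $GL(m,\mathbb{R})$ is the group of invertible real $m\times m$ matrices (linear maps and matrices are identified). The congruence orbit of $A\in\mathbb{R}^{m\times m}$ is $\mathcal{O}(A)=\{L^\top AL: L\in GL(m,\mathbb{R})\}$. A matrix $A$ is positive definite if $\langle Ax,x\rangle>0$ for all $x\in\mathbb{R}^m$, $x\neq 0$ (symmetry is not required). A cone is a nonempty set $K\subset\mathbb{R}^m$ with $K+K\subset K$ and $tK\subset K$ for all $t\ge 0$; its dual is $K^*=\{y\in\mathbb{R}^m:\langle x,y\rangle\ge 0\ \forall x\in K\}$. A simplicial cone is a set $\{t_1x^1+\dots+t_mx^m: t_i\ge 0,\ i=1,\dots,m\}$ with $x^1,\dots,x^m$ linearly independent vectors in $\mathbb{R}^m$. For a cone $K$, $A\in\mathbb{R}^{m\times m}$, $q\in\mathbb{R}^m$, the problem $\mathrm{LCP}(K,A,q)$ is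 to find $x\in\mathbb{R}^m$ with $x\in K$, $Ax+q\in K^*$ and $x\perp Ax+q$. The matrix $A$ has the $K$-Q-property if $\mathrm{LCP}(K,A,q)$ has a solution for all $q\in\mathbb{R}^m$; the $K$-P-property if $\mathrm{LCP}(K,A,q)$ has a unique solution for all $q\in\mathbb{R}^m$; the $K$-FS-property if $(AK+q)\cap K^*\neq\varnothing$ for all $q\in\mathbb{R}^m$. $A$ is called a Q-matrix, P-matrix, FS-matrix, respectively, if it has the corresponding property for $K=\mathbb{R}^m_+$. *)

theory Defs
  imports "HOL-Analysis.Analysis"
begin

definition congruence_orbit :: "real^'m^'m \<Rightarrow> (real^'m^'m) set" where
  "congruence_orbit A = {transpose L ** A ** L | L. invertible L}"

text \<open>Symmetry is not required.\<close>

definition positive_definite :: "real^'m^'m \<Rightarrow> bool" where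
  "positive_definite A \<longleftrightarrow> (\<forall>x. x \<noteq> 0 \<longrightarrow> (A *v x) \<bullet> x > 0)"

definition dual_cone :: "(real^'m) set \<Rightarrow> (real^'m) set" where
  "dual_cone K = {y. \<forall>x\<in>K. x \<bullet> y \<ge> 0}"

definition nonneg_orthant :: "(real^'m) set" where
  "nonneg_orthant = {x. \<forall>i. 0 \<le> x $ i}"

text \<open>The family \<open>x\<close> has exactly as many members as the dimension. As \<^const>\<open>independent\<close>
  speaks about sets, \<^term>\<open>inj x\<close> is needed for linear independence of the family.\<close>

definition simplicial_cone :: "(real^'m) set \<Rightarrow> bool" where
  "simplicial_cone K \<longleftrightarrow>
    (\<exists>x :: 'm \<Rightarrow> real^'m. inj x \<and> independent (range x) \<and>
      K = {\<Sum>i\<in>UNIV. t i *\<^sub>R x i | t. \<forall>i. 0 \<le> t i})"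

text \<open>The notions below are meant for cones \<open>K\<close>, in the sense of \<^const>\<open>convex_cone\<close>; the
  lemmas \<open>convex_cone_iff_add_scale\<close>, \<open>convex_cone_nonneg_orthant\<close> and
  \<open>simplicial_cone_imp_convex_cone\<close> show that this is closure under sums and nonnegative
  multiples, and that it holds for the orthant and for simplicial cones.\<close>

definition LCP_solution :: "(real^'m) set \<Rightarrow> real^'m^'m \<Rightarrow> real^'m \<Rightarrow> real^'m \<Rightarrow> bool" where
  "LCP_solution K A q x \<longleftrightarrow>
    x \<in> K \<and> A *v x + q \<in> dual_cone K \<and> orthogonal x (A *v x + q)"

definition Q_property :: "(real^'m) set \<Rightarrow> real^'m^'m \<Rightarrow> bool" where
  "Q_property K A \<longleftrightarrow> (\<forall>q. \<exists>x. LCP_solution K A q x)"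

definition P_property :: "(real^'m) set \<Rightarrow> real^'m^'m \<Rightarrow> bool" where
  "P_property K A \<longleftrightarrow> (\<forall>q. \<exists>!x. LCP_solution K A q x)"

definition FS_property :: "(real^'m) set \<Rightarrow> real^'m^'m \<Rightarrow> bool" where
  "FS_property K A \<longleftrightarrow> (\<forall>q. (\<lambda>x. A *v x + q) ` K \<inter> dual_cone K \<noteq> {})"

definition Q_matrix :: "real^'m^'m \<Rightarrow> bool" where
  "Q_matrix A \<longleftrightarrow> Q_property nonneg_orthant A"

definition P_matrix :: "real^'m^'m \<Rightarrow> bool" where
  "P_matrix A \<longleftrightarrow> P_property nonneg_orthant A"

definition FS_matrix :: "real^'m^'m \<Rightarrow> bool" where
  "FS_matrix A \<longleftrightarrow> FS_property nonneg_orthant A"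

lemma convex_cone_iff_add_scale:
  fixes K :: "(real^'m) set"
  shows "convex_cone K \<longleftrightarrow>
    K \<noteq> {} \<and> (\<forall>x\<in>K. \<forall>y\<in>K. x + y \<in> K) \<and> (\<forall>t\<ge>0. \<forall>x\<in>K. t *\<^sub>R x \<in> K)"
proof
  assume "convex_cone K"
  then show "K \<noteq> {} \<and> (\<forall>x\<in>K. \<forall>y\<in>K. x + y \<in> K) \<and> (\<forall>t\<ge>0. \<forall>x\<in>K. t *\<^sub>R x \<in> K)"
    by (auto simp: convex_cone_add convex_cone_scaleR convex_cone_nonempty)
next
  assume "K \<noteq> {} \<and> (\<forall>x\<in>K. \<forall>y\<in>K. x + y \<in> K) \<and> (\<forall>t\<ge>0. \<forall>x\<in>K. t *\<^sub>R x \<in> K)"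
  then show "convex_cone K"
    by (auto simp: convex_cone_def convex_def conic_def)
qed

lemma convex_cone_nonneg_orthant: "convex_cone (nonneg_orthant :: (real^'m) set)"
  unfolding convex_cone_iff_add_scale nonneg_orthant_def
  by (auto intro!: exI[of _ 0])

lemma simplicial_cone_imp_convex_cone:
  assumes "simplicial_cone K"
  shows "convex_cone K"
proof -
  obtain x :: "'a \<Rightarrow> real^'a"
    where K: "K = {\<Sum>i\<in>UNIV. t i *\<^sub>R x i | t. \<forall>i. 0 \<le> t i}"
    using assms unfolding simplicial_cone_def by blast
  have mem: "(\<Sum>i\<in>UNIV. t i *\<^sub>R x i) \<in> K" if "\<And>i. 0 \<le> t i" for t
    using that unfolding K by blast
  have "K \<noteq> {}"
    using mem[of "\<lambda>_. 0"] by auto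
  moreover have "u + v \<in> K" if "u \<in> K" "v \<in> K" for u v
  proof -
    obtain s t where "\<And>i. 0 \<le> s i" "u = (\<Sum>i\<in>UNIV. s i *\<^sub>R x i)"
      and "\<And>i. 0 \<le> t i" "v = (\<Sum>i\<in>UNIV. t i *\<^sub>R x i)"
      using \<open>u \<in> K\<close> \<open>v \<in> K\<close> unfolding K by blast
    then show ?thesis
      using mem[of "\<lambda>i. s i + t i"] by (simp add: scaleR_add_left sum.distrib)
  qed
  moreover have "c *\<^sub>R u \<in> K" if "0 \<le> c" "u \<in> K" for c u
  proof -
    obtain s where "\<And>i. 0 \<le> s i" "u = (\<Sum>i\<in>UNIV. s i *\<^sub>R x i)"
      using \<open>u \<in> K\<close> unfolding K by blast
    then show ?thesis
      using mem[of "\<lambda>i. c * s i"] \<open>0 \<le> c\<close> by (simp add: scaleR_sum_right)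
  qed
  ultimately show ?thesis
    unfolding convex_cone_iff_add_scale by blast
qed

end

theory Submission
  imports Defs
begin

text \<open>If \<open>A\<close> is positive definite, then for small \<open>r > 0\<close> the map \<open>x \<mapsto> x - r (A x + q)\<close> is a
  contraction, and so is its composition with the nearest-point projection onto a closed convex
  cone \<open>K\<close>; the fixed points of the composition are exactly the solutions of \<open>LCP(K, A, q)\<close>.
  Conversely, if \<open>\<langle>A z, z\<rangle> \<le> 0\<close> with \<open>z \<noteq> 0\<close>, extend \<open>z\<close> to a basis and flip the signs of the
  other basis vectors so that \<open>\<langle>A y, z\<rangle> \<le> 0\<close> for every basis vector \<open>y\<close>. In this basis \<open>A\<close> becomes a
  congruent matrix with a nonpositive row, which is not an FS-matrix.\<close>

section \<open>Projections and complementarity as variational inequalities\<close>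

text \<open>Two points satisfying the obtuse-angle inequality coincide: test each inequality at the
  other point and add, which bounds their squared distance by 0.\<close>

lemma closest_point_eq_iff:
  fixes K :: "'a::euclidean_space set"
  assumes "convex K" "closed K" "K \<noteq> {}"
  shows "closest_point K a = x \<longleftrightarrow> x \<in> K \<and> (\<forall>y\<in>K. (a - x) \<bullet> (y - x) \<le> 0)"
proof
  assume "closest_point K a = x"
  then show "x \<in> K \<and> (\<forall>y\<in>K. (a - x) \<bullet> (y - x) \<le> 0)"
    using assms closest_point_in_set closest_point_dot by blast
next
  assume x: "x \<in> K \<and> (\<forall>y\<in>K. (a - x) \<bullet> (y - x) \<le> 0)"
  let ?p = "closest_point K a"
  have "(a - x) \<bullet> (?p - x) \<le> 0" "(a - ?p) \<bullet> (x - ?p) \<le> 0"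
    using x assms by (simp_all add: closest_point_in_set closest_point_dot)
  then have "(?p - x) \<bullet> (?p - x) \<le> 0"
    by (simp add: inner_diff inner_commute)
  then show "?p = x"
    by (metis antisym inner_ge_zero inner_eq_zero_iff right_minus_eq)
qed

text \<open>Brings the problem into the form of the projection criterion. Testing at
  \<open>x + y\<close> yields membership in the dual cone; testing at 0 yields the missing half of
  orthogonality.\<close>

lemma LCP_solution_iff_variational:
  assumes "convex_cone K"
  shows "LCP_solution K A q x \<longleftrightarrow> x \<in> K \<and> (\<forall>y\<in>K. 0 \<le> (A *v x + q) \<bullet> (y - x))"
proof
  assume "LCP_solution K A q x"
  then show "x \<in> K \<and> (\<forall>y\<in>K. 0 \<le> (A *v x + q) \<bullet> (y - x))"
    by (auto simp: LCP_solution_def dual_cone_def orthogonal_def inner_diff inner_commute)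
next
  let ?w = "A *v x + q"
  assume x: "x \<in> K \<and> (\<forall>y\<in>K. 0 \<le> ?w \<bullet> (y - x))"
  have "0 \<le> ?w \<bullet> y" if "y \<in> K" for y
    using x that convex_cone_add[OF assms, of x y] by fastforce
  moreover have "?w \<bullet> x \<le> 0"
    using x convex_cone_contains_0[OF assms] by fastforce
  ultimately show "LCP_solution K A q x"
    using x unfolding LCP_solution_def dual_cone_def orthogonal_def
    by (auto simp: inner_commute intro: antisym)
qed

section \<open>Contraction from positive definiteness\<close>

text \<open>The constant is the minimum of the quadratic form on the compact unit sphere;
  homogeneity of degree 2 extends the bound to all vectors.\<close>

lemma positive_definite_coercive:
  fixes A :: "real^'m^'m"
  assumes "positive_definite A"
  obtains c where "0 < c" "\<And>x. c * (norm x)\<^sup>2 \<le> (A *v x) \<bullet> x"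
proof -
  let ?S = "sphere (0::real^'m) 1"
  have "axis undefined 1 \<in> ?S"
    by simp
  then have "?S \<noteq> {}"
    by blast
  moreover have "continuous_on ?S (\<lambda>x. (A *v x) \<bullet> x)"
    by (intro continuous_intros)
  ultimately obtain s where s: "s \<in> ?S" "\<And>x. x \<in> ?S \<Longrightarrow> (A *v s) \<bullet> s \<le> (A *v x) \<bullet> x"
    using continuous_attains_inf[OF compact_sphere] by blast
  show thesis
  proof
    have "s \<noteq> 0"
      using s(1) by auto
    then show "0 < (A *v s) \<bullet> s"
      using assms by (simp add: positive_definite_def)
    fix x :: "real^'m"
    show "(A *v s) \<bullet> s * (norm x)\<^sup>2 \<le> (A *v x) \<bullet> x"
    proof (cases "x = 0")
      case False
      define u where "u = x /\<^sub>R norm x"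
      have "x = norm x *\<^sub>R u" "u \<in> ?S"
        using False by (simp_all add: u_def)
      then have "(A *v x) \<bullet> x = (A *v u) \<bullet> u * (norm x)\<^sup>2"
        by (metis (no_types) inner_scaleR_left inner_scaleR_right matrix_vector_mult_scaleR
            mult.assoc mult.commute power2_eq_square)
      then show ?thesis
        using s(2)[OF \<open>u \<in> ?S\<close>] by (simp add: mult_right_mono)
    qed simp
  qed
qed

lemma norm_diff_scaleR_squared:
  fixes x a :: "'a::real_inner"
  shows "(norm (x - r *\<^sub>R a))\<^sup>2 = (norm x)\<^sup>2 - 2 * r * (a \<bullet> x) + r\<^sup>2 * (norm a)\<^sup>2"
  unfolding power2_norm_eq_inner inner_diff_left inner_diff_right
  by (simp add: inner_commute[of x a] power2_eq_square)

text \<open>With coercivity constant \<open>c\<close> and norm bound \<open>M\<close>, expanding the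
  square gives the factor \<open>1 - 2 * r * c + r^2 * M^2\<close>.\<close>

lemma positive_definite_contraction:
  fixes A :: "real^'m^'m"
  assumes "positive_definite A"
  obtains r k where "0 < r" "0 \<le> k" "k < 1" "\<And>x. norm (x - r *\<^sub>R (A *v x)) \<le> k * norm x"
proof -
  obtain c where c: "0 < c" "\<And>x. c * (norm x)\<^sup>2 \<le> (A *v x) \<bullet> x"
    using positive_definite_coercive[OF assms] by blast
  obtain B where B: "\<And>x. norm (A *v x) \<le> norm x * B"
    using bounded_linear.bounded[OF matrix_vector_mul_bounded_linear[of A]] by blast
  \<comment> \<open>The maximum with \<open>c\<close> ensures \<open>0 < M\<close> and
    \<open>c \<le> M\<close>, so that \<open>1 - r * c\<close> below is nonnegative and has a real
    square root.\<close>
  define M where "M = max B c"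
  have M: "0 < M" "c \<le> M"
    using c(1) by (auto simp: M_def)
  have AM: "norm (A *v x) \<le> M * norm x" for x
    using B[of x] mult_left_mono[of B M "norm x"] by (simp add: M_def mult.commute)
  \<comment> \<open>This \<open>r\<close> minimises the quadratic factor; its value there is
    \<open>1 - r * c\<close>.\<close>
  define r where "r = c / M\<^sup>2"
  define k where "k = sqrt (1 - r * c)"
  have r: "0 < r" "r * M\<^sup>2 = c"
    using c(1) M(1) by (simp_all add: r_def)
  have "r * c \<le> 1"
    using M c(1) mult_mono[of c M c M] by (simp add: r_def power2_eq_square)
  then have k: "0 \<le> k" "k\<^sup>2 = 1 - r * c"
    by (simp_all add: k_def)
  show thesis
  proof
    show "0 < r" by fact
    show "0 \<le> k" by fact
    show "k < 1"
      using r(1) c(1) by (simp add: k_def)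
    fix x :: "real^'m"
    have "(norm (x - r *\<^sub>R (A *v x)))\<^sup>2
        = (norm x)\<^sup>2 - 2 * r * ((A *v x) \<bullet> x) + r\<^sup>2 * (norm (A *v x))\<^sup>2"
      by (rule norm_diff_scaleR_squared)
    also have "\<dots> \<le> (norm x)\<^sup>2 - 2 * r * (c * (norm x)\<^sup>2) + r\<^sup>2 * (M * norm x)\<^sup>2"
    proof -
      have "2 * r * (c * (norm x)\<^sup>2) \<le> 2 * r * ((A *v x) \<bullet> x)"
        by (rule mult_left_mono[OF c(2)]) (use r(1) in simp)
      moreover have "r\<^sup>2 * (norm (A *v x))\<^sup>2 \<le> r\<^sup>2 * (M * norm x)\<^sup>2"
        by (rule mult_left_mono[OF power_mono[OF AM]]) simp_all
      ultimately show ?thesis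
        by linarith
    qed
    also have "r\<^sup>2 * (M * norm x)\<^sup>2 = r * (r * M\<^sup>2) * (norm x)\<^sup>2"
      by (simp add: power2_eq_square)
    also have "(norm x)\<^sup>2 - 2 * r * (c * (norm x)\<^sup>2) + r * (r * M\<^sup>2) * (norm x)\<^sup>2
        = (k * norm x)\<^sup>2"
      unfolding r(2) power_mult_distrib k(2) by (simp add: left_diff_distrib)
    finally show "norm (x - r *\<^sub>R (A *v x)) \<le> k * norm x"
      by (rule power2_le_imp_le) (simp add: k(1))
  qed
qed

lemma positive_definite_imp_P_property:
  fixes A :: "real^'m^'m"
  assumes "positive_definite A" "convex_cone K" "closed K"
  shows "P_property K A"
  unfolding P_property_def
proof
  fix q
  obtain r k where r: "0 < r" and k: "0 \<le> k" "k < 1"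
    and contr: "\<And>x. norm (x - r *\<^sub>R (A *v x)) \<le> k * norm x"
    using positive_definite_contraction[OF assms(1)] by blast
  have K: "convex K" "closed K" "K \<noteq> {}"
    using assms by (auto simp: convex_cone_def)
  define f where "f x = closest_point K (x - r *\<^sub>R (A *v x + q))" for x
  have "dist (f x) (f y) \<le> k * dist x y" for x y
  proof -
    have "dist (f x) (f y) \<le> dist (x - r *\<^sub>R (A *v x + q)) (y - r *\<^sub>R (A *v y + q))"
      unfolding f_def using closest_point_lipschitz[OF K] .
    \<comment> \<open>The vector \<open>q\<close> cancels, so only the linear part matters.\<close>
    also have "\<dots> = norm ((x - y) - r *\<^sub>R (A *v (x - y)))"
      by (simp add: dist_norm matrix_vector_mult_diff_distrib algebra_simps)
    also have "\<dots> \<le> k * dist x y"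
      using contr by (simp add: dist_norm)
    finally show ?thesis .
  qed
  then have "\<exists>!x. f x = x"
    using banach_fix_type[OF k] by blast
  \<comment> \<open>The projected point minus \<open>x\<close> is
    \<open>- r *\<^sub>R (A *v x + q)\<close>; since \<open>0 < r\<close>, the projection criterion
    is the variational inequality.\<close>
  moreover have "f x = x \<longleftrightarrow> LCP_solution K A q x" for x
    using r unfolding f_def closest_point_eq_iff[OF K] LCP_solution_iff_variational[OF assms(2)]
    by (simp add: zero_le_mult_iff)
  ultimately show "\<exists>!x. LCP_solution K A q x"
    by simp
qed

section \<open>Implications between the properties; closedness of the cones\<close>

lemma P_property_imp_Q_property: "P_property K A \<Longrightarrow> Q_property K A"
  unfolding P_property_def Q_property_def by blast

lemma Q_property_imp_FS_property: "Q_property K A \<Longrightarrow> FS_property K A"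
  unfolding Q_property_def FS_property_def LCP_solution_def by blast

lemma closed_nonneg_orthant: "closed (nonneg_orthant :: (real^'m) set)"
  unfolding nonneg_orthant_def by (intro closed_Collect_all closed_Collect_le continuous_intros)

text \<open>Such a cone is the convex cone hull of finitely many vectors, and finitely generated
  cones are closed.\<close>

lemma simplicial_cone_imp_closed:
  assumes "simplicial_cone K"
  shows "closed K"
proof -
  obtain x :: "'a \<Rightarrow> real^'a"
    where K: "K = {\<Sum>i\<in>UNIV. t i *\<^sub>R x i | t. \<forall>i. 0 \<le> t i}"
    using assms unfolding simplicial_cone_def by blast
  have "x j \<in> K" for j
    unfolding K
    by (intro CollectI exI[of _ "\<lambda>i. if i = j then 1 else 0"])
      (simp add: if_distrib[of "\<lambda>c. c *\<^sub>R _"] cong: if_cong)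
  then have "convex_cone hull (range x) \<subseteq> K"
    using simplicial_cone_imp_convex_cone[OF assms] by (intro hull_minimal) auto
  \<comment> \<open>An arbitrary finite index set allows induction; the case \<open>UNIV\<close> is
    the one needed.\<close>
  moreover have "(\<Sum>i\<in>I. t i *\<^sub>R x i) \<in> convex_cone hull (range x)"
    if "finite I" "\<And>i. 0 \<le> t i" for t I
    using that(1)
    by induction
      (auto intro!: convex_cone_hull_add convex_cone_hull_mul
        simp: that(2) convex_cone_hull_contains_0 hull_inc)
  then have "K \<subseteq> convex_cone hull (range x)"
    unfolding K by auto
  ultimately have "K = convex_cone hull (range x)"
    by blast
  then show ?thesis
    by (simp add: closed_convex_cone_hull)
qed

section \<open>Congruent matrices and the converse direction\<close>

text \<open>Serves both directions: it transfers definiteness along the orbit and reads entries of a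
  congruent matrix as values of the form of \<open>A\<close> on columns of \<open>L\<close>.\<close>

lemma inner_congruence:
  fixes A L :: "real^'m^'m"
  shows "((transpose L ** A ** L) *v x) \<bullet> y = (A *v (L *v x)) \<bullet> (L *v y)"
  by (simp add: dot_lmul_matrix flip: matrix_vector_mul_assoc)

lemma positive_definite_congruence_orbit:
  assumes "positive_definite A" "B \<in> congruence_orbit A"
  shows "positive_definite B"
proof -
  obtain L where B: "B = transpose L ** A ** L" and L: "invertible L"
    using assms(2) unfolding congruence_orbit_def by blast
  have "L *v x \<noteq> 0" if "x \<noteq> 0" for x
    using L that invertible_left_inverse[of L] matrix_left_invertible_ker[of L] by blast
  then show ?thesis
    using assms(1) unfolding positive_definite_def B inner_congruence by blast
qed

text \<open>Nonnegative vectors are sent to vectors with nonpositive coordinate \<open>i\<close>, so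
  the shift \<open>q = - axis i 1\<close> cannot be compensated.\<close>

lemma not_FS_matrix_if_nonpos_row:
  assumes "\<And>j. B $ i $ j \<le> 0"
  shows "\<not> FS_matrix B"
proof
  assume "FS_matrix B"
  then obtain x where x: "x \<in> nonneg_orthant" "B *v x - axis i 1 \<in> dual_cone nonneg_orthant"
    unfolding FS_matrix_def FS_property_def
    by (metis (no_types, lifting) IntE equals0I imageE uminus_add_conv_diff add.commute)
  have "axis i 1 \<in> nonneg_orthant"
    by (simp add: nonneg_orthant_def axis_def)
  then have "0 \<le> axis i 1 \<bullet> (B *v x - axis i 1)"
    using x(2) by (auto simp: dual_cone_def)
  moreover have "axis i (1::real) $ i = 1"
    by (simp add: axis_def)
  ultimately have "1 \<le> (B *v x) $ i"
    by (simp add: inner_axis')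
  moreover have "(B *v x) $ i \<le> 0"
    using x(1) assms
    by (auto simp: matrix_vector_mult_def nonneg_orthant_def intro!: sum_nonpos mult_nonpos_nonneg)
  ultimately show False
    by simp
qed

text \<open>Take a diagonal sign matrix and replace column \<open>k\<close> by \<open>z\<close>,
  where \<open>z $ k\<close> is nonzero. The signs put the other columns into the half-space given
  by \<open>v\<close>.\<close>

lemma ex_invertible_column_inner_nonpos:
  fixes z v :: "real^'m"
  assumes "z \<noteq> 0" "z \<bullet> v \<le> 0"
  obtains L :: "real^'m^'m" and k
  where "invertible L" "column k L = z" "\<And>j. column j L \<bullet> v \<le> 0"
proof -
  obtain k where k: "z $ k \<noteq> 0"
    using assms(1) by (auto simp: vec_eq_iff)
  \<comment> \<open>Chosen so that \<open>s j * v $ j = - \<bar>v $ j\<bar>\<close>.\<close>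
  define s :: "'m \<Rightarrow> real" where "s j = (if v $ j \<le> 0 then 1 else -1)" for j
  define L :: "real^'m^'m"
    where "L = (\<chi> i j. if j = k then z $ i else if i = j then s j else 0)"
  have col: "column j L = (if j = k then z else axis j (s j))" for j
    by (auto simp: column_def L_def axis_def vec_eq_iff)
  have "x = 0" if "L *v x = 0" for x
  proof -
    \<comment> \<open>Split off column \<open>k\<close>: row \<open>k\<close> then involves only
      \<open>x $ k\<close>, and once this vanishes every other row determines its own
      coordinate.\<close>
    have Lx: "(L *v x) $ i = z $ i * x $ k + (if i = k then 0 else s i * x $ i)" for i
      unfolding matrix_vector_mult_def L_def
      by (subst vec_lambda_beta, subst sum.remove[of _ k])
        (auto simp: if_distrib[of "\<lambda>c. c * _"] cong: if_cong)
    have "x $ k = 0"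
      using Lx[of k] that k by simp
    then have "x $ i = 0" for i
      using Lx[of i] that by (auto simp: s_def split: if_splits)
    then show ?thesis
      by (simp add: vec_eq_iff)
  qed
  then have "invertible L"
    using invertible_left_inverse matrix_left_invertible_ker by blast
  moreover have "column j L \<bullet> v \<le> 0" for j
    using assms(2) by (auto simp: col inner_axis' s_def)
  ultimately show thesis
    using that[of L k] col by simp
qed

lemma positive_definite_if_orbit_FS:
  fixes A :: "real^'m^'m"
  assumes FS: "\<forall>B\<in>congruence_orbit A. FS_matrix B"
  shows "positive_definite A"
  unfolding positive_definite_def
proof (intro allI impI, rule ccontr)
  fix z :: "real^'m"
  \<comment> \<open>Moving \<open>A\<close> to the other side turns the sign conditions on basis
    vectors into membership in one half-space, with normal \<open>transpose A *v z\<close>.\<close>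
  have adj: "(A *v x) \<bullet> z = x \<bullet> (transpose A *v z)" for x
    by (metis dot_lmul_matrix inner_commute transpose_matrix_vector)
  assume "z \<noteq> 0" "\<not> 0 < (A *v z) \<bullet> z"
  then have "z \<bullet> (transpose A *v z) \<le> 0"
    by (simp only: adj not_less)
  with \<open>z \<noteq> 0\<close> obtain L :: "real^'m^'m" and k
    where L: "invertible L" "column k L = z" "\<And>j. column j L \<bullet> (transpose A *v z) \<le> 0"
    using ex_invertible_column_inner_nonpos[of z "transpose A *v z"] by metis
  let ?B = "transpose L ** A ** L"
  have "?B $ k $ j \<le> 0" for j
  proof -
    \<comment> \<open>Column \<open>k\<close> of \<open>L\<close> is \<open>z\<close>, so row
      \<open>k\<close> pairs the images under \<open>A\<close> of all columns with
      \<open>z\<close>.\<close>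
    have "?B $ k $ j = (?B *v axis j 1) \<bullet> axis k 1"
      by (simp add: inner_axis matrix_vector_mul_component)
    also have "\<dots> = column j L \<bullet> (transpose A *v z)"
      unfolding inner_congruence unfolding matrix_vector_mult_basis L(2) by (rule adj)
    finally show ?thesis
      using L(3) by simp
  qed
  then have "\<not> FS_matrix ?B"
    by (rule not_FS_matrix_if_nonpos_row)
  then show False
    using FS L(1) unfolding congruence_orbit_def by blast
qed

theorem theorem1:
  fixes A :: "real^'m^'m"
  shows "((\<forall>B\<in>congruence_orbit A. FS_matrix B) \<longleftrightarrow> (\<forall>B\<in>congruence_orbit A. Q_matrix B)) \<and>
    ((\<forall>B\<in>congruence_orbit A. Q_matrix B) \<longleftrightarrow> (\<forall>B\<in>congruence_orbit A. P_matrix B)) \<and>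
    ((\<forall>B\<in>congruence_orbit A. P_matrix B) \<longleftrightarrow> positive_definite A) \<and>
    ((\<forall>B\<in>congruence_orbit A. FS_matrix B) \<or> (\<forall>B\<in>congruence_orbit A. Q_matrix B) \<or>
      (\<forall>B\<in>congruence_orbit A. P_matrix B) \<or> positive_definite A \<longrightarrow>
      (\<forall>K :: (real^'m) set. simplicial_cone K \<longrightarrow>
        P_property K A \<and> Q_property K A \<and> FS_property K A))"
proof -
  let ?on = "\<lambda>prop. \<forall>B\<in>congruence_orbit A. prop B"
  \<comment> \<open>The equivalences are closed as a cycle: definite, P, Q, FS, definite.\<close>
  have "?on P_matrix" if "positive_definite A"
    using that positive_definite_congruence_orbit convex_cone_nonneg_orthant closed_nonneg_orthant
    unfolding P_matrix_def by (blast intro: positive_definite_imp_P_property)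
  moreover have "?on P_matrix \<Longrightarrow> ?on Q_matrix"
    unfolding P_matrix_def Q_matrix_def by (blast intro: P_property_imp_Q_property)
  moreover have "?on Q_matrix \<Longrightarrow> ?on FS_matrix"
    unfolding Q_matrix_def FS_matrix_def by (blast intro: Q_property_imp_FS_property)
  moreover have "?on FS_matrix \<Longrightarrow> positive_definite A"
    by (rule positive_definite_if_orbit_FS)
  moreover have "P_property K A \<and> Q_property K A \<and> FS_property K A"
    if "positive_definite A" "simplicial_cone K" for K
    using that positive_definite_imp_P_property simplicial_cone_imp_convex_cone
      simplicial_cone_imp_closed P_property_imp_Q_property Q_property_imp_FS_property
    by blast
  ultimately show ?thesis
    by blast
qed

end
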